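(* Let $d\ge 1$ be an integer and let $T$ be the complete binary tree of depth $d$. Then \[\Phi_V(T)\ge \Big\lfloor \frac{d-\lceil \log_2(3d)\rceil}{2}\Big\rfloor \ge \frac{d-\log_2 d}{2}-\frac{3+\log_2 3}{2}.\]
   Context: The complete binary tree of depth $d$ is the rooted tree in which every vertex at distance less than $d$ from the root has exactly $2$ children, and the vertices at distance $d$ from the root are leaves. For a graph $G$ and $S\subseteq V(G)$, $\delta(S)=\{v\in V(G)\setminus S : N(v)\cap S\neq\emptyset\}$; $\Phi_V(G,s)=\min_{|S|=s}|\delta(S)|$ and $\Phi_V(G)=\max_{0\le s\le |V(G)|}\Phi_V(G,s)$. *)

theory Defs
  imports "Graph_Theory.Graph_Theory"
begin

text \<open>
  A finite simple graph is a digraph satisfying the locale predicate \<^const>\<open>graph\<close>: finite,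
  loop-free, without parallel arcs, and symmetric, so that an edge is a pair of opposite arcs.
\<close>

definition neighbourhood :: "('a, 'b) pre_digraph \<Rightarrow> 'a \<Rightarrow> 'a set" where
  "neighbourhood G v = {u. v \<rightarrow>\<^bsub>G\<^esub> u}"

definition vertex_boundary :: "('a, 'b) pre_digraph \<Rightarrow> 'a set \<Rightarrow> 'a set" where
  "vertex_boundary G S = {v \<in> verts G - S. neighbourhood G v \<inter> S \<noteq> {}}"

text \<open>
  For finite \<open>G\<close> the set under \<^const>\<open>Min\<close> is finite, and it is nonempty exactly when
  \<open>s \<le> card (verts G)\<close>; only such \<open>s\<close> are used in \<open>isoperimetric_peak\<close>.
\<close>

definition vertex_isoperimetric :: "('a, 'b) pre_digraph \<Rightarrow> nat \<Rightarrow> nat" where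
  "vertex_isoperimetric G s =
     Min ((\<lambda>S. card (vertex_boundary G S)) ` {S. S \<subseteq> verts G \<and> card S = s})"

definition isoperimetric_peak :: "('a, 'b) pre_digraph \<Rightarrow> nat" where
  "isoperimetric_peak G = Max (vertex_isoperimetric G ` {0..card (verts G)})"

text \<open>
  The library's \<^const>\<open>tree\<close> is unsuitable here: it forbids all directed cycles, but every edge of a
  symmetric digraph gives a directed cycle of length 2. The cycles of a simple graph are the
  directed cycles of length at least 3.
\<close>

definition undirected_tree :: "('a, 'b) pre_digraph \<Rightarrow> bool" where
  "undirected_tree G \<longleftrightarrow>
     graph G \<and> connected G \<and> \<not> (\<exists>p. pre_digraph.cycle G p \<and> 3 \<le> length p)"

definition graph_dist :: "('a, 'b) pre_digraph \<Rightarrow> 'a \<Rightarrow> 'a \<Rightarrow> ereal" where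
  "graph_dist G = wf_digraph.\<mu> G (\<lambda>_. 1)"

definition children :: "('a, 'b) pre_digraph \<Rightarrow> 'a \<Rightarrow> 'a \<Rightarrow> 'a set" where
  "children G r v = {w \<in> neighbourhood G v. graph_dist G r w = graph_dist G r v + 1}"

text \<open>
  The last condition says that the vertices at distance \<open>d\<close> are leaves; by connectedness there are
  then no vertices at distance greater than \<open>d\<close>.
\<close>

definition complete_binary_tree :: "('a, 'b) pre_digraph \<Rightarrow> 'a \<Rightarrow> nat \<Rightarrow> bool" where
  "complete_binary_tree T r d \<longleftrightarrow>
     undirected_tree T \<and> r \<in> verts T \<and>
     (\<forall>v \<in> verts T. graph_dist T r v < ereal (real d) \<longrightarrow> card (children T r v) = 2) \<and>
     (\<forall>v \<in> verts T. graph_dist T r v = ereal (real d) \<longrightarrow> children T r v = {})"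

end

theory Submission
  imports Defs
begin

text \<open>
  Let \<open>B\<close> be the boundary of \<open>S\<close> and \<open>k = |B|\<close>. The components of \<open>T - B\<close> lie inside or outside of
  \<open>S\<close>, and each is a full subtree, of size \<open>2^h - 1\<close>, minus the full subtrees below it at vertices of
  \<open>B\<close>. Charging these terms to the vertices of \<open>B\<close> shows that, up to an error between \<open>-k\<close> and
  \<open>2k + 1\<close>, \<open>|S|\<close> is a sum of at most \<open>k + 1\<close> signed powers of two. The bound follows by taking
  \<open>|S| = d + 2^m (1 + 4 + \<dots> + 4^q)\<close> with \<open>2^m \<ge> 3d\<close>: the error is absorbed in the lowest \<open>m\<close> bits,
  and the alternating upper bits require \<open>q + 1\<close> signed powers of two.
\<close>

section \<open>Sums of signed powers of two\<close>

text \<open>Admitting the summand 0 makes \<open>w\<close> an upper bound on the number of signed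
  powers, so the sets grow with \<open>w\<close>.\<close>

primrec signed_power_sums :: "nat \<Rightarrow> int set" where
  "signed_power_sums 0 = {0}"
| "signed_power_sums (Suc w) =
     {x + y | x y. x \<in> signed_power_sums w \<and> (y = 0 \<or> (\<exists>j. y = 2 ^ j \<or> y = - (2 ^ j)))}"

declare signed_power_sums.simps(2) [simp del]

lemma signed_power_sums_SucI:
  assumes "x \<in> signed_power_sums w" "y = 0 \<or> (\<exists>j. y = 2 ^ j \<or> y = - (2 ^ j))"
  shows "x + y \<in> signed_power_sums (Suc w)"
  using assms unfolding signed_power_sums.simps by blast

lemma signed_power_sums_mono_Suc: "x \<in> signed_power_sums w \<Longrightarrow> x \<in> signed_power_sums (Suc w)"
  using signed_power_sums_SucI[of x w 0] by simp

lemma signed_power_sums_add_power: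
  assumes "x \<in> signed_power_sums w"
  shows "x + 2 ^ j \<in> signed_power_sums (Suc w)" "x - 2 ^ j \<in> signed_power_sums (Suc w)"
  using signed_power_sums_SucI[OF assms, of "2 ^ j"] signed_power_sums_SucI[OF assms, of "- (2 ^ j)"]
  by auto

lemma signed_power_sums_succ_pred:
  assumes "x \<in> signed_power_sums w"
  shows "x + 1 \<in> signed_power_sums (Suc w)" "x - 1 \<in> signed_power_sums (Suc w)"
  using signed_power_sums_add_power[OF assms, of 0] by simp_all

lemma signed_power_sums_add:
  assumes "x \<in> signed_power_sums a" "y \<in> signed_power_sums b"
  shows "x + y \<in> signed_power_sums (a + b)"
  using assms(2)
proof (induction b arbitrary: y)
  case 0
  then show ?case using assms(1) by simp
next
  case (Suc b)
  then obtain y' z where y: "y = y' + z" "y' \<in> signed_power_sums b"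
    and z: "z = 0 \<or> (\<exists>j. z = 2 ^ j \<or> z = - (2 ^ j))"
    by (auto simp: signed_power_sums.simps(2))
  from signed_power_sums_SucI[OF Suc.IH[OF y(2)] z] y(1) show ?case
    by (simp add: add.assoc)
qed

text \<open>Halving turns each even summand into a smaller power. An odd sum must contain a unit 1
  or -1; dropping it before halving saves one summand, and its sign decides between rounding down
  and rounding up.\<close>

lemma signed_power_sums_parity:
  assumes "x \<in> signed_power_sums w"
  shows "(even x \<longrightarrow> x div 2 \<in> signed_power_sums w) \<and>
         (odd x \<longrightarrow> (\<exists>w'. w = Suc w' \<and>
            (x div 2 \<in> signed_power_sums w' \<or> x div 2 + 1 \<in> signed_power_sums w')))"
  using assms
proof (induction w arbitrary: x)
  case 0
  then show ?case by simp
next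
  case (Suc w)
  then obtain y z where x: "x = y + z" and y: "y \<in> signed_power_sums w"
    and z: "z = 0 \<or> (\<exists>j. z = 2 ^ j \<or> z = - (2 ^ j))"
    by (auto simp: signed_power_sums.simps(2))
  note IH = Suc.IH[OF y]
  \<comment> \<open>Units are the only nonzero summands that affect the parity; all other powers are
    twice a power and survive the halving.\<close>
  consider "z = 0" | "z = 1" | "z = -1"
    | j where "z = 2 * 2 ^ j" | j where "z = 2 * - (2 ^ j)"
  proof -
    have "\<exists>i. (2::int) ^ j = 2 * 2 ^ i" if "j \<noteq> 0" for j
      using that by (metis not0_implies_Suc power_Suc)
    then show ?thesis using z that
      by (metis mult_minus_right power_0)
  qed
  then show ?case
  proof cases
    case 1
    then show ?thesis using IH x signed_power_sums_mono_Suc by (metis add.right_neutral)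
  next
    case 2
    show ?thesis
    proof (cases "even y")
      case True
      then have "x div 2 = y div 2" "odd x" using x 2 by auto
      then show ?thesis using IH True by auto
    next
      case False
      \<comment> \<open>The new unit cancels the unit in \<open>y\<close> or produces a carry. The
        carry costs one summand, which the halving of the odd \<open>y\<close> has saved.\<close>
      then have "x div 2 = y div 2 + 1" "even x" using x 2 by presburger+
      moreover from IH False obtain w' where w: "w = Suc w'"
        and "y div 2 \<in> signed_power_sums w' \<or> y div 2 + 1 \<in> signed_power_sums w'" by blast
      then have "y div 2 + 1 \<in> signed_power_sums (Suc w)"
        using signed_power_sums_succ_pred(1) signed_power_sums_mono_Suc by metis
      ultimately show ?thesis by simp
    qed
  next
    case 3
    show ?thesis
    proof (cases "even y")
      case True
      then have "x div 2 + 1 = y div 2" "odd x" using x 3 by presburger+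
      then show ?thesis using IH True by auto
    next
      case False
      then have "x div 2 = y div 2" "even x" using x 3 by presburger+
      moreover from IH False obtain w' where w: "w = Suc w'"
        and "y div 2 \<in> signed_power_sums w' \<or> y div 2 + 1 \<in> signed_power_sums w'" by blast
      then have "y div 2 \<in> signed_power_sums (Suc w)"
        using signed_power_sums_succ_pred(2) signed_power_sums_mono_Suc
        by (metis add_diff_cancel_right')
      ultimately show ?thesis by simp
    qed
  next
    case (4 j)
    have "x div 2 = y div 2 + 2 ^ j" "x div 2 + 1 = (y div 2 + 1) + 2 ^ j" "even x \<longleftrightarrow> even y"
      using x 4 by auto
    then show ?thesis using IH signed_power_sums_add_power(1) by metis
  next
    case (5 j)
    have "x div 2 = y div 2 - 2 ^ j" "x div 2 + 1 = (y div 2 + 1) - 2 ^ j" "even x \<longleftrightarrow> even y"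
      using x 5 by presburger+
    then show ?thesis using IH signed_power_sums_add_power(2) by metis
  qed
qed

text \<open>If rounding down calls for a correction by -1, the sum was odd and the summand saved by
  halving pays for it. So discarding low bits never increases the number of summands.\<close>

lemma signed_power_sums_div2:
  assumes "x \<in> signed_power_sums w"
  shows "x div 2 \<in> signed_power_sums w"
  using signed_power_sums_parity[OF assms] signed_power_sums_mono_Suc
    signed_power_sums_succ_pred(2) by (metis add_diff_cancel_right')

lemma signed_power_sums_div_power:
  assumes "x \<in> signed_power_sums w"
  shows "x div 2 ^ m \<in> signed_power_sums w"
proof (induction m)
  case (Suc m)
  have "x div 2 ^ Suc m = x div 2 ^ m div 2"
    by (metis power_Suc2 zdiv_zmult2_eq zero_le_numeral)
  then show ?case using signed_power_sums_div2[OF Suc] by simp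
qed (use assms in simp)

text \<open>The binary expansion \<open>10101\<dots>01\<close> is the non-adjacent form, hence a shortest signed
  representation.\<close>
lemma signed_power_sums_alternating:
  assumes "(\<Sum>i\<le>q. 4 ^ i) \<in> signed_power_sums w"
  shows "q < w"
  using assms
proof (induction q arbitrary: w)
  case 0
  then show ?case by (cases w) auto
next
  case (Suc q)
  define u :: int where "u = (\<Sum>i\<le>q. 4 ^ i)"
  have "(\<Sum>i\<le>Suc q. 4 ^ i) = 4 * u + (1 :: int)"
    by (subst sum.atMost_Suc_shift) (simp add: u_def sum_distrib_left)
  moreover have "odd (4 * u + 1)" "(4 * u + 1) div 2 = 2 * u" by presburger+
  ultimately obtain w' where w: "w = Suc w'"
    and "2 * u \<in> signed_power_sums w' \<or> 2 * u + 1 \<in> signed_power_sums w'"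
    using signed_power_sums_parity[OF Suc.prems] by auto
  \<comment> \<open>The first halving, of an odd number, costs one summand. Both roundings lead to
    \<open>u\<close> at the second halving, which cannot bring it back.\<close>
  moreover have "2 * u div 2 = u" "(2 * u + 1) div 2 = u" by presburger+
  ultimately have "u \<in> signed_power_sums w'" using signed_power_sums_div2 by metis
  then show ?case using Suc.IH w u_def by simp
qed

text \<open>Each boundary vertex may contribute one signed power and an error between -1 and 2. The
  window is linear in \<open>k\<close> so that contributions of disjoint subtrees add up.\<close>

definition near_signed_power_sums :: "nat \<Rightarrow> int set" where
  "near_signed_power_sums k =
     {n. \<exists>e. - int k \<le> e \<and> e \<le> 2 * int k \<and> n + e \<in> signed_power_sums k}"

lemma near_signed_power_sums_add:
  assumes "x \<in> near_signed_power_sums a" "y \<in> near_signed_power_sums b"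
  shows "x + y \<in> near_signed_power_sums (a + b)"
proof -
  obtain e f where ef: "- int a \<le> e" "e \<le> 2 * int a" "x + e \<in> signed_power_sums a"
    "- int b \<le> f" "f \<le> 2 * int b" "y + f \<in> signed_power_sums b"
    using assms by (auto simp: near_signed_power_sums_def)
  have "(x + y) + (e + f) \<in> signed_power_sums (a + b)"
    using signed_power_sums_add[OF ef(3,6)] by (simp add: algebra_simps)
  then show ?thesis unfolding near_signed_power_sums_def
    using ef by (intro CollectI exI[of _ "e + f"]) auto
qed

lemma near_signed_power_sums_1I:
  assumes "n + e = 0 \<or> n + e = 2 ^ j \<or> n + e = - (2 ^ j)" "- 1 \<le> e" "e \<le> 2"
  shows "n \<in> near_signed_power_sums 1"
  unfolding near_signed_power_sums_def using assms
  by (intro CollectI exI[of _ e]) (auto simp: signed_power_sums.simps(2))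

lemma zero_near_signed_power_sums: "0 \<in> near_signed_power_sums 0"
  by (simp add: near_signed_power_sums_def)

section \<open>Vertex sets in levelled binary trees\<close>

text \<open>The counting sees only the parent-child relation \<open>P\<close> and the levels.
  Acyclicity of the graph enters through \<open>parent_unique\<close>.\<close>

locale levelled_binary_tree =
  fixes V :: "'a set" and P :: "('a \<times> 'a) set" and lev :: "'a \<Rightarrow> nat" and d :: nat
  assumes finite_V: "finite V"
    and P_subset: "P \<subseteq> V \<times> V"
    and lev_child: "(u, v) \<in> P \<Longrightarrow> lev v = Suc (lev u)"
    and parent_unique: "(u, w) \<in> P \<Longrightarrow> (v, w) \<in> P \<Longrightarrow> u = v"
    and inner: "v \<in> V \<Longrightarrow> lev v < d \<Longrightarrow> card (P `` {v}) = 2"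
    and leaf: "v \<in> V \<Longrightarrow> lev v = d \<Longrightarrow> P `` {v} = {}"
begin

definition descendants :: "'a \<Rightarrow> 'a set" where
  "descendants v = P\<^sup>* `` {v}"

lemma descendants_lev: "x \<in> descendants v \<Longrightarrow> x = v \<or> lev v < lev x"
proof -
  assume "x \<in> descendants v"
  then have "(v, x) \<in> P\<^sup>*" by (simp add: descendants_def)
  then show ?thesis by induction (auto dest: lev_child)
qed

lemma descendants_unfold: "descendants v = insert v (\<Union>c\<in>P `` {v}. descendants c)"
  by (auto simp: descendants_def elim: converse_rtranclE intro: converse_rtrancl_into_rtrancl)

lemma descendants_subset: "v \<in> V \<Longrightarrow> descendants v \<subseteq> V"
proof
  fix x assume v: "v \<in> V" and "x \<in> descendants v"
  then have "(v, x) \<in> P\<^sup>*" by (simp add: descendants_def)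
  then show "x \<in> V" using v P_subset by induction auto
qed

text \<open>From a common descendant, unique parents force both descending paths to agree edge by
  edge going up; equal levels make them end at the same vertex.\<close>

lemma descendants_disjoint:
  assumes "lev c = lev c'" "c \<noteq> c'"
  shows "descendants c \<inter> descendants c' = {}"
proof -
  have "c = c'" if "(c, x) \<in> P\<^sup>*" "(c', x) \<in> P\<^sup>*" for x
    using that
  proof (induction)
    case base
    then show ?case using descendants_lev[of c c'] assms(1) by (auto simp: descendants_def)
  next
    case (step y z)
    have "lev c < lev z"
      using step.hyps descendants_lev[of y c] lev_child by (fastforce simp: descendants_def)
    with step.prems assms(1) obtain y' where "(c', y') \<in> P\<^sup>*" "(y', z) \<in> P"
      by (metis less_irrefl rtranclE)
    then show ?case using step parent_unique by metis
  qed
  then show ?thesis using assms(2) by (auto simp: descendants_def)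
qed

text \<open>The set \<open>X\<close> is arbitrary because the recursion is applied to
  \<open>UNIV\<close>, to \<open>S\<close> and to \<open>B\<close>.\<close>

lemma card_descendants_split:
  assumes "v \<in> V" "P `` {v} = {c, c'}" "c \<noteq> c'"
  shows "card (X \<inter> descendants v) =
    (if v \<in> X then 1 else 0) + card (X \<inter> descendants c) + card (X \<inter> descendants c')"
proof -
  have lev: "lev c = Suc (lev v)" "lev c' = Suc (lev v)" and cV: "c \<in> V" "c' \<in> V"
    using assms(2) lev_child P_subset by blast+
  have fin: "finite (descendants c)" "finite (descendants c')"
    using cV descendants_subset finite_V finite_subset by blast+
  have v: "v \<notin> descendants c" "v \<notin> descendants c'"
    using descendants_lev lev by fastforce+
  have disj: "descendants c \<inter> descendants c' = {}"
    using descendants_disjoint assms(3) lev by simp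
  have "X \<inter> descendants v = (X \<inter> {v}) \<union> ((X \<inter> descendants c) \<union> (X \<inter> descendants c'))"
    using descendants_unfold[of v] assms(2) by auto
  also have "card \<dots> = card (X \<inter> {v}) + (card (X \<inter> descendants c) + card (X \<inter> descendants c'))"
    using fin v disj by (subst card_Un_disjoint; (subst card_Un_disjoint)?) auto
  finally show ?thesis by auto
qed

lemma two_children:
  assumes "v \<in> V" "lev v < d"
  obtains c c' where "P `` {v} = {c, c'}" "c \<noteq> c'"
  using inner[OF assms] by (auto simp: card_2_iff)

lemma card_descendants:
  assumes "v \<in> V" "lev v + h = d"
  shows "card (descendants v) = 2 ^ Suc h - 1"
  using assms
proof (induction h arbitrary: v)
  case 0
  then show ?case using descendants_unfold[of v] leaf by simp
next
  case (Suc h)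
  then obtain c c' where c: "P `` {v} = {c, c'}" "c \<noteq> c'" using two_children[of v] by auto
  then have cP: "(v, c) \<in> P" "(v, c') \<in> P" by auto
  then have "c \<in> V" "c' \<in> V" "lev c + h = d" "lev c' + h = d"
    using Suc.prems lev_child[OF cP(1)] lev_child[OF cP(2)] P_subset by auto
  then have "card (descendants c) = 2 ^ Suc h - 1" "card (descendants c') = 2 ^ Suc h - 1"
    using Suc.IH by auto
  then show ?case using card_descendants_split[OF Suc.prems(1) c, of UNIV]
    by (simp add: algebra_simps)
qed

text \<open>A vertex of \<open>B\<close> may be the child of a vertex inside or of a vertex outside of \<open>S\<close>; in the
  former case the parent counts a full subtree, hence the two alternatives for \<open>v \<in> B\<close>.\<close>
lemma card_Int_descendants:
  assumes S: "S \<inter> B = {}"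
    and down: "\<And>u v. (u, v) \<in> P \<Longrightarrow> u \<in> S \<Longrightarrow> v \<in> S \<union> B"
    and up: "\<And>u v. (u, v) \<in> P \<Longrightarrow> v \<in> S \<Longrightarrow> u \<in> S \<union> B"
    and "v \<in> V" "lev v + h = d"
  defines "a \<equiv> \<lambda>v. int (card (S \<inter> descendants v))"
    and "k \<equiv> \<lambda>v. card (B \<inter> descendants v)"
  shows "(v \<notin> S \<longrightarrow> a v \<in> near_signed_power_sums (k v)) \<and>
         (v \<in> S \<union> B \<longrightarrow> a v - (2 ^ Suc h - 1) \<in> near_signed_power_sums (k v))"
  using assms(4,5)
proof (induction h arbitrary: v)
  case 0
  then have D: "descendants v = {v}" using descendants_unfold[of v] leaf by simp
  have "0 \<in> near_signed_power_sums 1"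
    by (rule near_signed_power_sums_1I[of _ 0]) auto
  moreover have "- 1 \<in> near_signed_power_sums 1"
    by (rule near_signed_power_sums_1I[of _ 1]) auto
  ultimately show ?case using S zero_near_signed_power_sums
    by (cases "v \<in> S"; cases "v \<in> B") (auto simp: a_def k_def D)
next
  case (Suc h)
  then obtain c c' where c: "P `` {v} = {c, c'}" "c \<noteq> c'" using two_children[of v] by auto
  then have cP: "(v, c) \<in> P" "(v, c') \<in> P" by auto
  then have cV: "c \<in> V" "c' \<in> V" "lev c + h = d" "lev c' + h = d"
    using Suc.prems lev_child[OF cP(1)] lev_child[OF cP(2)] P_subset by auto
  define M :: int where "M = 2 ^ Suc h - 1"
  have M: "2 ^ Suc (Suc h) - 1 = 2 * M + 1" by (simp add: M_def)
  note IH = Suc.IH[OF cV(1,3), folded M_def] Suc.IH[OF cV(2,4), folded M_def]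
  have a: "a v = (if v \<in> S then 1 else 0) + a c + a c'"
    and k: "k v = (if v \<in> B then 1 else 0) + k c + k c'"
    using card_descendants_split[OF Suc.prems(1) c] by (auto simp: a_def k_def)
  show ?case
  proof (cases "v \<in> B")
    case False
    show ?thesis
    proof (cases "v \<in> S")
      case True
      \<comment> \<open>Both children can be compared with full subtrees, and \<open>v\<close>
        itself accounts for the 1 in \<open>2 * M + 1\<close>: no new summand or error
        arises.\<close>
      then have "c \<in> S \<union> B" "c' \<in> S \<union> B" using down cP by blast+
      with IH have "(a c - M) + (a c' - M) \<in> near_signed_power_sums (k c + k c')"
        by (blast intro: near_signed_power_sums_add)
      moreover have "a v - (2 * M + 1) = (a c - M) + (a c' - M)" using a True by simp
      ultimately have "a v - (2 * M + 1) \<in> near_signed_power_sums (k c + k c')" by metis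
      then show ?thesis unfolding M using k False True by simp
    next
      case vS: False
      then have "c \<notin> S" "c' \<notin> S" using up cP False by blast+
      with IH have "a c + a c' \<in> near_signed_power_sums (k c + k c')"
        by (blast intro: near_signed_power_sums_add)
      then show ?thesis using a k False vS by simp
    qed
  next
    case True
    \<comment> \<open>Each child is compared with a full subtree if it lies in \<open>S\<close> and
      with the empty set otherwise. The sum of these reference values is 0, \<open>M\<close> or
      \<open>2 * M\<close>, and it is charged to \<open>v\<close>.\<close>
    define \<beta> \<beta>' where "\<beta> = (if c \<in> S then M else 0)" and "\<beta>' = (if c' \<in> S then M else 0)"
    have "a c - \<beta> \<in> near_signed_power_sums (k c)" "a c' - \<beta>' \<in> near_signed_power_sums (k c')"
      using IH by (auto simp: \<beta>_def \<beta>'_def)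
    then have rest: "(a c - \<beta>) + (a c' - \<beta>') \<in> near_signed_power_sums (k c + k c')"
      by (rule near_signed_power_sums_add)
    have "v \<notin> S" using True S by auto
    \<comment> \<open>These are the six possible charges to \<open>v\<close>. The errors 2 for
      \<open>2 * M\<close> and -1 for \<open>- (2 * M + 1)\<close> are the extremes that fix the
      window.\<close>
    have "0 \<in> near_signed_power_sums 1"
      by (rule near_signed_power_sums_1I[of _ 0]) auto
    moreover have "M \<in> near_signed_power_sums 1"
      by (rule near_signed_power_sums_1I[of _ 1 "Suc h"]) (auto simp: M_def)
    moreover have "2 * M \<in> near_signed_power_sums 1"
      by (rule near_signed_power_sums_1I[of _ 2 "Suc (Suc h)"]) (auto simp: M_def)
    moreover have "- (2 * M + 1) \<in> near_signed_power_sums 1"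
      by (rule near_signed_power_sums_1I[of _ "-1" "Suc (Suc h)"]) (auto simp: M_def)
    moreover have "M - (2 * M + 1) \<in> near_signed_power_sums 1"
      by (rule near_signed_power_sums_1I[of _ 0 "Suc h"]) (auto simp: M_def)
    moreover have "2 * M - (2 * M + 1) \<in> near_signed_power_sums 1"
      by (rule near_signed_power_sums_1I[of _ 1]) auto
    ultimately have "\<beta> + \<beta>' \<in> near_signed_power_sums 1"
      "\<beta> + \<beta>' - (2 * M + 1) \<in> near_signed_power_sums 1"
      by (auto simp: \<beta>_def \<beta>'_def algebra_simps)
    from this[THEN near_signed_power_sums_add, OF rest]
    have "a c + a c' \<in> near_signed_power_sums (1 + (k c + k c'))"
      "a c + a c' - (2 * M + 1) \<in> near_signed_power_sums (1 + (k c + k c'))"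
      by (simp_all add: algebra_simps)
    then show ?thesis using a k True \<open>v \<notin> S\<close> unfolding M by simp
  qed
qed

end

section \<open>Rooted trees\<close>

locale rooted_tree = graph T for T :: "('a, 'b) pre_digraph" +
  fixes r :: 'a
  assumes undirected_tree: "undirected_tree T"
    and root: "r \<in> verts T"
begin

text \<open>Distances are extended reals; by \<open>shortest_walk\<close> those of vertices are
  finite and integral, so the conversion loses nothing there.\<close>

definition lev :: "'a \<Rightarrow> nat" where
  "lev v = nat \<lfloor>real_of_ereal (graph_dist T r v)\<rfloor>"

lemma shortest_walk:
  assumes "v \<in> verts T"
  shows "graph_dist T r v = ereal (real (lev v))" "\<exists>p. awalk r p v \<and> length p = lev v"
proof -
  have "strongly_connected T"
    using undirected_tree sym_arcs symmetric_connected_imp_strongly_connected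
    by (auto simp: undirected_tree_def)
  then have "r \<rightarrow>\<^sup>*\<^bsub>T\<^esub> v" using assms root by auto
  then obtain p where p: "apath r p v" "\<mu> (\<lambda>_. 1) r v = awalk_cost (\<lambda>_. 1) p"
    using min_cost_awalk[of r v "\<lambda>_. 1"] by auto
  have "awalk_cost (\<lambda>_. 1) p = real (length p)" by (induction p) auto
  then have *: "graph_dist T r v = ereal (real (length p))" using p by (simp add: graph_dist_def)
  then have "lev v = length p" by (simp add: lev_def)
  then show "graph_dist T r v = ereal (real (lev v))" "\<exists>p. awalk r p v \<and> length p = lev v"
    using * p awalkI_apath by auto
qed

lemma lev_le_length: "awalk r p v \<Longrightarrow> lev v \<le> length p"
proof -
  assume p: "awalk r p v"
  have "awalk_cost (\<lambda>_. 1) p = real (length p)" by (induction p) auto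
  then have "graph_dist T r v \<le> ereal (real (length p))"
    using min_cost_le_walk_cost[OF p, of "\<lambda>_. 1"] by (simp add: graph_dist_def)
  then show ?thesis using shortest_walk(1)[of v] awalk_last_in_verts[OF p] by simp
qed

lemma lev_root: "lev r = 0"
  using lev_le_length[of "[]" r] root by (simp add: awalk_Nil_iff)

lemma lev_eq_0: "v \<in> verts T \<Longrightarrow> lev v = 0 \<Longrightarrow> v = r"
  using shortest_walk(2)[of v] by (auto simp: awalk_Nil_iff)

text \<open>The parent is the last but one vertex of a shortest walk to \<open>v\<close>; a shorter
  walk to it would give a shorter walk to \<open>v\<close>.\<close>

lemma parent_exists:
  assumes "v \<in> verts T" "lev v = Suc n"
  obtains u where "u \<in> verts T" "u \<rightarrow>\<^bsub>T\<^esub> v" "lev u = n"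
proof -
  obtain p where p: "awalk r p v" "length p = Suc n" using shortest_walk(2) assms by metis
  then obtain q e where q: "p = q @ [e]" by (metis length_Suc_conv_rev)
  then have w: "awalk r q (tail T e)" "e \<in> arcs T" "head T e = v" "length q = n"
    using p by (auto simp: awalk_simps)
  obtain q' where q': "awalk r q' (tail T e)" "length q' = lev (tail T e)"
    using shortest_walk(2) w(2) tail_in_verts by metis
  have "awalk r (q' @ [e]) v"
    using q'(1) w by (intro awalk_appendI) (auto simp: awalk_simps)
  then have "n \<le> lev (tail T e)"
    using lev_le_length[of "q' @ [e]" v] q'(2) assms(2) by simp
  moreover have "lev (tail T e) \<le> n" using lev_le_length w by blast
  moreover have "tail T e \<rightarrow>\<^bsub>T\<^esub> v" using w in_arcs_imp_in_arcs_ends by metis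
  ultimately show ?thesis using that w(2) tail_in_verts le_antisym by metis
qed

text \<open>Following parents never rises above the starting level. Both directions are recorded so
  that two vertices can be joined through \<open>r\<close>.\<close>

lemma walks_to_root:
  assumes "v \<in> verts T" "lev v = n"
  shows "\<exists>p q. awalk r p v \<and> awalk v q r \<and>
    (\<forall>x \<in> set (awalk_verts r p) \<union> set (awalk_verts v q). lev x \<le> n)"
  using assms
proof (induction n arbitrary: v)
  case 0
  then have "v = r" using lev_eq_0 by simp
  then have "awalk r [] v \<and> awalk v [] r \<and>
      (\<forall>x \<in> set (awalk_verts r []) \<union> set (awalk_verts v []). lev x \<le> 0)"
    using root lev_root by (simp add: awalk_Nil_iff)
  then show ?case by blast
next
  case (Suc n)
  then obtain u where u: "u \<in> verts T" "u \<rightarrow>\<^bsub>T\<^esub> v" "lev u = n" using parent_exists by metis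
  obtain p q where pq: "awalk r p u" "awalk u q r"
    "\<forall>x \<in> set (awalk_verts r p) \<union> set (awalk_verts u q). lev x \<le> n"
    using Suc.IH[OF u(1,3)] by blast
  obtain e where e: "e \<in> arcs T" "tail T e = u" "head T e = v" using u(2) by (rule reachableE)
  obtain f where f: "f \<in> arcs T" "tail T f = v" "head T f = u"
    using graph_symmetric[OF u(2)] by (rule reachableE)
  have 1: "awalk r (p @ [e]) v" using pq(1) e by (intro awalk_appendI) (auto simp: awalk_simps)
  have 2: "awalk v (f # q) r" using pq(2) f by (simp add: awalk_simps)
  have "set (awalk_verts r (p @ [e])) \<subseteq> insert v (set (awalk_verts r p))"
  proof -
    have "u \<in> set (awalk_verts r p)"
      using pq(1) last_in_set[OF awalk_verts_non_Nil] by (metis awalkE')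
    then show ?thesis using set_awalk_verts[OF 1] set_awalk_verts[OF pq(1)] e by auto
  qed
  moreover have "set (awalk_verts v (f # q)) = insert v (set (awalk_verts u q))" using f by simp
  ultimately have "set (awalk_verts r (p @ [e])) \<union> set (awalk_verts v (f # q)) \<subseteq>
      insert v (set (awalk_verts r p) \<union> set (awalk_verts u q))" by blast
  moreover have "\<forall>x \<in> insert v (set (awalk_verts r p) \<union> set (awalk_verts u q)). lev x \<le> Suc n"
    using pq(3) Suc.prems(2) by (simp add: ball_Un le_SucI)
  ultimately have "\<forall>x \<in> set (awalk_verts r (p @ [e])) \<union> set (awalk_verts v (f # q)). lev x \<le> Suc n"
    by blast
  then show ?case using 1 2 by blast
qed

text \<open>Two parents of \<open>w\<close> would be joined by a path through \<open>r\<close> that stays below the level of \<open>w\<close>, and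
  \<open>w\<close> would close this path to a cycle.\<close>
lemma parent_unique:
  assumes "u \<rightarrow>\<^bsub>T\<^esub> w" "v \<rightarrow>\<^bsub>T\<^esub> w" "lev w = Suc (lev u)" "lev w = Suc (lev v)"
  shows "u = v"
proof (rule ccontr)
  assume "u \<noteq> v"
  obtain e where e: "e \<in> arcs T" "tail T e = u" "head T e = w" using assms(1) by (rule reachableE)
  obtain f where f: "f \<in> arcs T" "tail T f = w" "head T f = v"
    using graph_symmetric[OF assms(2)] by (rule reachableE)
  have verts: "u \<in> verts T" "v \<in> verts T" using e f by auto
  obtain q where q: "awalk v q r" "\<forall>x \<in> set (awalk_verts v q). lev x \<le> lev u"
    using walks_to_root[OF verts(2)] assms(3,4) by force
  obtain p where p: "awalk r p u" "\<forall>x \<in> set (awalk_verts r p). lev x \<le> lev u"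
    using walks_to_root[OF verts(1)] by force
  have qp: "awalk v (q @ p) u" using q(1) p(1) by (rule awalk_appendI)
  define t where "t = awalk_to_apath (q @ p)"
  have t: "apath v t u" using apath_awalk_to_apath[OF qp] by (simp add: t_def)
  have "set (awalk_verts v t) \<subseteq> set (awalk_verts v (q @ p))"
    using awalk_to_apath_subset[OF qp] set_awalk_verts[OF qp] set_awalk_verts[OF awalkI_apath[OF t]]
    by (auto simp: t_def)
  also have "\<dots> \<subseteq> set (awalk_verts v q) \<union> set (awalk_verts r p)"
    using set_awalk_verts[OF qp] set_awalk_verts[OF q(1)] set_awalk_verts[OF p(1)] by auto
  finally have w: "w \<notin> set (awalk_verts v t)" using p(2) q(2) assms(3) by fastforce
  \<comment> \<open>With at least one arc in \<open>t\<close>, the closed walk through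
    \<open>w\<close> reaches length 3 and is not just an edge traversed back and forth.\<close>
  have "t \<noteq> []" using t \<open>u \<noteq> v\<close> by (auto simp: apath_Nil_iff)
  then have len: "3 \<le> length (f # t @ [e])" by (cases t) auto
  have "awalk u [e] w" using e arc_implies_awalk by blast
  then have te: "awalk v (t @ [e]) w" using awalk_appendI awalkI_apath[OF t] by blast
  then have "awalk w (f # t @ [e]) w" using f awalk_Cons_iff by metis
  moreover have "awalk_verts v (t @ [e]) = awalk_verts v t @ [w]"
  proof -
    have "awlast v t = u" using t by (auto simp: apath_def)
    then show ?thesis using e \<open>t \<noteq> []\<close>
      by (auto simp: awalk_verts_conv)
  qed
  then have "distinct (tl (awalk_verts w (f # t @ [e])))"
    using t w f by (simp add: apath_def)
  ultimately have "cycle (f # t @ [e])" unfolding cycle_def by blast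
  then show False using undirected_tree len unfolding undirected_tree_def by blast
qed

definition child_rel :: "('a \<times> 'a) set" where
  "child_rel = {(u, v). v \<in> children T r u}"

lemma child_rel_iff: "(u, v) \<in> child_rel \<longleftrightarrow> u \<rightarrow>\<^bsub>T\<^esub> v \<and> lev v = Suc (lev u)"
proof (cases "u \<rightarrow>\<^bsub>T\<^esub> v")
  case True
  then have "u \<in> verts T" "v \<in> verts T" by (auto elim!: reachableE)
  then show ?thesis using True shortest_walk(1)
    by (auto simp: child_rel_def children_def neighbourhood_def)
qed (simp add: child_rel_def children_def neighbourhood_def)

lemma reachable_child_rel: "v \<in> verts T \<Longrightarrow> (r, v) \<in> child_rel\<^sup>*"
proof (induction "lev v" arbitrary: v)
  case 0
  then show ?case using lev_eq_0 by fastforce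
next
  case (Suc n)
  then obtain u where "u \<in> verts T" "u \<rightarrow>\<^bsub>T\<^esub> v" "lev u = n" using parent_exists by metis
  then show ?case using Suc child_rel_iff by (metis rtrancl.rtrancl_into_rtrancl)
qed

end

section \<open>Counting vertex sets in complete binary trees\<close>

lemma complete_binary_tree_levels:
  assumes "complete_binary_tree T r d"
  shows "rooted_tree T r"
    and "levelled_binary_tree (verts T) (rooted_tree.child_rel T r) (rooted_tree.lev T r) d"
proof -
  show *: "rooted_tree T r"
    using assms by (simp add: complete_binary_tree_def undirected_tree_def rooted_tree_def
        rooted_tree_axioms_def)
  interpret rooted_tree T r by (rule *)
  have image: "child_rel `` {v} = children T r v" for v by (auto simp: child_rel_def)
  show "levelled_binary_tree (verts T) child_rel lev d"
  proof
    show "child_rel \<subseteq> verts T \<times> verts T" by (auto simp: child_rel_iff elim!: reachableE)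
    show "u = v" if "(u, w) \<in> child_rel" "(v, w) \<in> child_rel" for u v w
      using that parent_unique[of u w v] by (simp add: child_rel_iff)
  qed (use assms shortest_walk(1) image in \<open>auto simp: complete_binary_tree_def child_rel_iff\<close>)
qed

text \<open>The subtree count is applied at the root. If \<open>r\<close> lies in \<open>S\<close>,
  it measures the deviation from the whole tree, and adding back \<open>2 ^ Suc d - 1\<close> costs
  one more summand and raises the error by 1.\<close>

lemma complete_binary_tree_card:
  assumes "complete_binary_tree T r d"
  shows "card (verts T) = 2 ^ Suc d - 1"
    and "S \<subseteq> verts T \<Longrightarrow> k = card (vertex_boundary T S) \<Longrightarrow>
      \<exists>e. - int k \<le> e \<and> e \<le> 2 * int k + 1 \<and> int (card S) + e \<in> signed_power_sums (Suc k)"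
proof -
  interpret rooted_tree T r by (rule complete_binary_tree_levels[OF assms])
  interpret levelled_binary_tree "verts T" child_rel lev d
    by (rule complete_binary_tree_levels[OF assms])
  have D: "descendants r = verts T"
    using descendants_subset[OF root] reachable_child_rel by (auto simp: descendants_def)
  show "card (verts T) = 2 ^ Suc d - 1"
    using card_descendants[OF root, of d] lev_root D by simp
  assume S: "S \<subseteq> verts T" and k: "k = card (vertex_boundary T S)"
  let ?B = "vertex_boundary T S"
  have B: "?B \<subseteq> verts T" "S \<inter> ?B = {}" by (auto simp: vertex_boundary_def)
  \<comment> \<open>By symmetry of the arcs this serves both directions: from a parent in
    \<open>S\<close> to its child and from a child in \<open>S\<close> to its parent.\<close>
  have boundary: "v \<in> ?B" if "u \<rightarrow>\<^bsub>T\<^esub> v" "u \<in> S" "v \<notin> S" for u v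
  proof -
    have "v \<rightarrow>\<^bsub>T\<^esub> u" using graph_symmetric that(1) by blast
    moreover have "v \<in> verts T" using that(1) by (auto elim!: reachableE)
    ultimately show ?thesis using that by (auto simp: vertex_boundary_def neighbourhood_def)
  qed
  have "S \<inter> descendants r = S" "?B \<inter> descendants r = ?B" using S B D by auto
  moreover have "v \<in> S \<union> ?B" if "(u, v) \<in> child_rel" "u \<in> S" for u v
    using that boundary child_rel_iff by blast
  moreover have "u \<in> S \<union> ?B" if "(u, v) \<in> child_rel" "v \<in> S" for u v
    using that boundary child_rel_iff graph_symmetric by blast
  ultimately have *: "r \<notin> S \<longrightarrow> int (card S) \<in> near_signed_power_sums k"
      "r \<in> S \<longrightarrow> int (card S) - (2 ^ Suc d - 1) \<in> near_signed_power_sums k"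
    using card_Int_descendants[of S ?B r d] B(2) root lev_root k by auto
  show "\<exists>e. - int k \<le> e \<and> e \<le> 2 * int k + 1 \<and> int (card S) + e \<in> signed_power_sums (Suc k)"
  proof (cases "r \<in> S")
    case True
    with * obtain e where e: "- int k \<le> e" "e \<le> 2 * int k"
      "int (card S) - (2 ^ Suc d - 1) + e \<in> signed_power_sums k"
      by (auto simp: near_signed_power_sums_def)
    have "int (card S) + (e + 1) \<in> signed_power_sums (Suc k)"
      using signed_power_sums_add_power(1)[OF e(3), of "Suc d"] by (simp add: algebra_simps)
    then show ?thesis using e by (intro exI[of _ "e + 1"]) auto
  next
    case False
    with * obtain e where "- int k \<le> e" "e \<le> 2 * int k"
      "int (card S) + e \<in> signed_power_sums k"
      by (auto simp: near_signed_power_sums_def)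
    then show ?thesis using signed_power_sums_mono_Suc by force
  qed
qed

section \<open>Lower bound for the isoperimetric peak\<close>

lemma isoperimetric_peak_geI:
  assumes "finite (verts G)" "s \<le> card (verts G)"
    and "\<And>S. S \<subseteq> verts G \<Longrightarrow> card S = s \<Longrightarrow> q \<le> card (vertex_boundary G S)"
  shows "q \<le> isoperimetric_peak G"
proof -
  \<comment> \<open>A set of size \<open>s\<close> must exist, since \<open>Min\<close> of an empty
    set has no usable value.\<close>
  obtain S where "S \<subseteq> verts G" "card S = s"
    using obtain_subset_with_card_n[OF assms(2)] by metis
  then have "q \<le> vertex_isoperimetric G s"
    unfolding vertex_isoperimetric_def using assms by (subst Min_ge_iff) auto
  also have "\<dots> \<le> isoperimetric_peak G"
    unfolding isoperimetric_peak_def using assms(2) by (intro Max_ge) auto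
  finally show ?thesis .
qed

lemma complete_binary_tree_peak:
  assumes "complete_binary_tree T r d" "3 * d \<le> 2 ^ m" "m + 2 * q \<le> d"
  shows "q \<le> isoperimetric_peak T"
proof (cases "q = 0")
  case False
  define t :: nat where "t = (\<Sum>i\<le>q. 4 ^ i)"
  define s where "s = d + 2 ^ m * t"
  \<comment> \<open>The geometric sum gives \<open>3 * s \<le> 4 * 2 ^ d\<close>; as
    \<open>q > 0\<close> forces \<open>d > 0\<close>, a set of size \<open>s\<close> fits into the
    tree.\<close>
  have "3 * t + 1 = 4 ^ Suc q" unfolding t_def by (induction q) auto
  then have "2 ^ m * (3 * t + 1) = 4 * 2 ^ (m + 2 * q)"
    by (simp add: power_add power_mult)
  moreover have "(2::nat) ^ (m + 2 * q) \<le> 2 ^ d" using assms(3) by (intro power_increasing) auto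
  ultimately have "2 ^ m * (3 * t + 1) \<le> 4 * 2 ^ d" by simp
  then have "3 * s \<le> 4 * 2 ^ d" using assms(2) by (simp add: s_def algebra_simps)
  moreover have "(2::nat) ^ 1 \<le> 2 ^ d" using assms(3) False by (intro power_increasing) auto
  ultimately have s: "s \<le> 2 ^ Suc d - 1" by simp
  have fin: "finite (verts T)"
    using complete_binary_tree_levels(2)[OF assms(1)] by (simp add: levelled_binary_tree_def)
  show ?thesis
  proof (rule isoperimetric_peak_geI[OF fin, of s])
    show "s \<le> card (verts T)" using s complete_binary_tree_card(1)[OF assms(1)] by simp
    fix S assume S: "S \<subseteq> verts T" "card S = s"
    define k where "k = card (vertex_boundary T S)"
    obtain e where e: "- int k \<le> e" "e \<le> 2 * int k + 1"
      "int s + e \<in> signed_power_sums (Suc k)"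
      using complete_binary_tree_card(2)[OF assms(1) S(1) k_def] S(2) by blast
    show "q \<le> card (vertex_boundary T S)"
    proof (rule ccontr)
      assume "\<not> ?thesis"
      then have "k < q" by (simp add: k_def)
      \<comment> \<open>From \<open>k < q\<close> and \<open>2 * q \<le> d\<close>, the error lies
        between \<open>- d\<close> and \<open>2 * d\<close>. The offset \<open>d\<close> in
        \<open>s\<close> makes it nonnegative and \<open>2 ^ m \<ge> 3 * d\<close> keeps it from
        carrying, so division by \<open>2 ^ m\<close> leaves exactly \<open>t\<close>.\<close>
      then have "0 \<le> int d + e" "int d + e < 3 * int d" using e assms(3) by linarith+
      moreover have "3 * int d \<le> 2 ^ m"
        using assms(2) by (metis of_nat_mult of_nat_numeral of_nat_power zle_int)
      ultimately have "(int d + e + 2 ^ m * int t) div 2 ^ m = int t" by simp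
      then have "int t \<in> signed_power_sums (Suc k)"
        using signed_power_sums_div_power[OF e(3), of m] by (simp add: s_def algebra_simps)
      then have "q < Suc k" by (intro signed_power_sums_alternating) (simp add: t_def)
      with \<open>k < q\<close> show False by simp
    qed
  qed
qed simp

theorem theorem3p3:
  fixes T :: "('a, 'b) pre_digraph" and r :: 'a and d :: nat
  assumes "d \<ge> 1"
    and "complete_binary_tree T r d"
  shows "int (isoperimetric_peak T)
           \<ge> \<lfloor>(real d - real_of_int \<lceil>log 2 (3 * real d)\<rceil>) / 2\<rfloor> \<and>
         real_of_int \<lfloor>(real d - real_of_int \<lceil>log 2 (3 * real d)\<rceil>) / 2\<rfloor>
           \<ge> (real d - log 2 (real d)) / 2 - (3 + log 2 3) / 2"
proof
  define c where "c = \<lceil>log 2 (3 * real d)\<rceil>"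
  have "0 \<le> log 2 (3 * real d)" using assms(1) by (subst zero_le_log_cancel_iff) auto
  then have c_pos: "0 \<le> c" by (simp add: c_def)
  define m where "m = nat c"
  have "log 2 (3 * real d) \<le> real m" using c_pos unfolding m_def c_def by linarith
  then have "3 * real d \<le> 2 powr real m" using assms(1) by (simp add: log_le_iff)
  then have "real (3 * d) \<le> real (2 ^ m)" by (simp add: powr_realpow)
  then have m: "3 * d \<le> 2 ^ m" by linarith
  have floor: "\<lfloor>(real d - real_of_int c) / 2\<rfloor> = (int d - c) div 2"
    using floor_divide_of_int_eq[of "int d - c" 2] by simp
  show "int (isoperimetric_peak T) \<ge> \<lfloor>(real d - real_of_int \<lceil>log 2 (3 * real d)\<rceil>) / 2\<rfloor>"
  \<comment> \<open>For \<open>c > d\<close> the claimed bound is at most 0; otherwise it is a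
    natural number and can serve as \<open>q\<close>.\<close>
  proof (cases "c \<le> int d")
    case True
    define q where "q = nat ((int d - c) div 2)"
    have q: "int q = (int d - c) div 2" using True by (simp add: q_def)
    then have "m + 2 * q \<le> d" using c_pos True unfolding m_def by linarith
    then show ?thesis
      using complete_binary_tree_peak[OF assms(2) m, of q] q floor unfolding c_def by linarith
  next
    case False
    then have "(int d - c) div 2 \<le> 0" by simp
    then show ?thesis using floor by (simp add: c_def)
  qed
  \<comment> \<open>The floor loses at most 1/2, and the ceiling loses less than 1, hence less than
    1/2 after halving. Together this stays within the allowed 3/2.\<close>
  have "int d - c \<le> 2 * ((int d - c) div 2) + 1" by linarith
  then have "real_of_int (int d - c) \<le> real_of_int (2 * ((int d - c) div 2) + 1)"
    by (simp only: of_int_le_iff)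
  moreover have "real_of_int c < log 2 3 + log 2 (real d) + 1"
  proof -
    have "log 2 (3 * real d) = log 2 3 + log 2 (real d)" using assms(1) by (simp add: log_mult)
    then show ?thesis unfolding c_def by linarith
  qed
  ultimately show "real_of_int \<lfloor>(real d - real_of_int \<lceil>log 2 (3 * real d)\<rceil>) / 2\<rfloor>
      \<ge> (real d - log 2 (real d)) / 2 - (3 + log 2 3) / 2"
    unfolding floor[unfolded c_def] c_def by (simp add: field_simps)
qed

end
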